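(* Consider a finite message set $\mathcal M$, a rule $\pi\in\Pi_{\mathcal M}$, and let $y$ be a solution of the minimization problem (P) for the rule $\pi$, i.e. $y\in\arg\min_{x\in\mathcal Y_{\mathcal M}}\Phi_\pi(x)$. Then the rule $\tilde\pi\in\Pi_\Gamma$ defined by $$\tilde\pi_\gamma^{od}(\theta)=\sum_{m\in\mathcal M}y_{\gamma m}^{od}\,\pi_m^{od}(\theta),\qquad \forall o,d\in\mathcal V,\ \forall\gamma\in\Gamma,$$ is direct and obedient. Moreover, $f^{\pi}=f^{\tilde\pi}$ (the Bayesian Wardrop equilibria of the two rules coincide), and therefore $\pi$ and $\tilde\pi$ achieve the same cost, $C(f^\pi)=C(f^{\tilde\pi})$.
   Context: Network. $\mathcal G=(\mathcal V,\mathcal E,\sigma,\xi)$ is a directed multigraph with non-empty finite node set $\mathcal V$, finite link set $\mathcal E$, tail map $\sigma:\mathcal E\to\mathcal V$ and head map $\xi:\mathcal E\to\mathcal V$, without self-loops. For distinct nodes $o\neq d$, an $(o,d)$-path is a tuple of links $(e_1,\dots,e_l)$, $l\ge 1$, with $\sigma(e_1)=o$, $\xi(e_l)=d$, $\xi(e_i)=\sigma(e_{i+1})$ for $1\le i<l$, and $\sigma(e_i)\ne\sigma(e_j)$ for $1\le i<j\le l$. $\Gamma_{od}$ is the (finite) set of $(o,d)$-paths and $\Gamma=\bigcup_{o\ne d}\Gamma_{od}$. $A\in\{0,1\}^{\mathcal E\times\Gamma}$ is the link-path incidence matrix: $A_{e\gamma}=1$ if link $e$ belongs to path $\gamma$ and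 $A_{e\gamma}=0$ otherwise. The throughput is a nonnegative matrix $\upsilon\in\mathbb R_+^{\mathcal V\times\mathcal V}$ with zero diagonal and $\upsilon_{od}=0$ whenever $d$ is not reachable from $o$ (i.e. $\Gamma_{od}=\emptyset$); $\upsilon_{od}$ is the mass of users with origin $o$ and destination $d$. State and delays. The network state $\Theta$ is a random vector on a complete probability space with values in $\mathbb R_+^{\mathcal E}$, whose entries have finite first and second moments; $d\mathbb P(\theta)$ denotes integration with respect to its law. Each link $e$ has a measurable delay function $\tau_e:\mathbb R_+\times\mathbb R_+\to\mathbb R_+$, $(\theta_e,f_e)\mapsto\tau_e(\theta_e,f_e)$, which is continuously differentiable, strictly increasing and convex in $f_e$ for every $\theta_e$. Path costs are $c_\gamma(\theta,f)=\sum_{e\in\mathcal E}A_{e\gamma}\tau_e(\theta_e,f_e)$. The system cost of a network flow $f$ (a function assigning a link flow vector $f(\theta)\in\mathbb R_+^{\mathcal E}$ compatible with $\upsilon$ to each $\theta\in\mathbb R_+^{\mathcal E}$) is $C(f)=\mathbb E\big[\sum_{e\in\mathcal E} f_e(\Theta)\tau_e(\Theta_e,f_e(\Theta))\big]$. Signaling rules and equilibria. For a finite message set $\mathcal M$, $\Pi_{\mathcal M}$ is the set of (signaling) rules, i.e. maps $\pi:\mathbb R_+^{\mathcal E}\to\mathbb R_+^{\mathcal V\times\mathcal V\times\mathcal M}$ with $\sum_{m\in\mathcal M}\pi_m^{od}(\theta)=1$ for all $o,d\in\mathcal V$; $\pi_m^{od}(\theta)$ is the conditional probability that a user with origin $o$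 and destination $d$ receives message $m$ given $\Theta=\theta$ (and the fraction of such users that receive $m$). $\mathcal Y_{\mathcal M}$ is the set of $y\in\mathbb R_+^{\mathcal V\times\mathcal V\times\Gamma\times\mathcal M}$ such that, for every two nodes $o,d\in\mathcal V$ and every $m\in\mathcal M$, $y_{\gamma m}^{od}=0$ for all $\gamma\notin\Gamma_{od}$ and $\sum_{\gamma\in\Gamma}y_{\gamma m}^{od}=1$; $y_{\gamma m}^{od}$ is the fraction of users from $o$ to $d$ who choose path $\gamma$ among those who received message $m$. For $\pi\in\Pi_{\mathcal M}$ and $y\in\mathcal Y_{\mathcal M}$ let $$f_e^{\pi,y}(\theta)=\sum_{o,d\in\mathcal V}\sum_{\gamma\in\Gamma_{od}}A_{e\gamma}\sum_{m\in\mathcal M}y_{\gamma m}^{od}\pi_m^{od}(\theta)\upsilon_{od},\qquad \Phi_\pi(y)=\int_{\mathbb R_+^{\mathcal E}}\sum_{e\in\mathcal E}\int_0^{f_e^{\pi,y}(\theta)}\tau_e(\theta_e,s)\,ds\,d\mathbb P(\theta).$$ Problem (P) for the rule $\pi$ is the minimization of $\Phi_\pi$ over $\mathcal Y_{\mathcal M}$. The flow $f^{\pi,y}$ is a Bayesian Wardrop equilibrium (BWE) for $\pi$ if for every two nodes $o,d\in\mathcal V$, $i\in\Gamma_{od}$ and $m\in\mathcal M$ with $y_{im}^{od}>0$, the inequality $\int_{\mathbb R_+^{\mathcal E}}\big(c_i(\theta,f^{\pi,y}(\theta))-c_j(\theta,f^{\pi,y}(\theta))\big)\pi_m^{od}(\theta)\,d\mathbb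 P(\theta)\le0$ holds for every $j\in\Gamma_{od}$. The paper establishes that $f^{\pi,y}$ is a BWE if and only if $y$ solves (P), and that the BWE is unique for every rule $\pi$; it is denoted $f^\pi$, and the cost of the rule $\pi$ is $C(f^\pi)$. Direct and obedient rules. A rule $\pi$ is direct if $\mathcal M=\Gamma$ and $\pi^{od}_\gamma(\theta)=0$ for all $o,d\in\mathcal V$, all $\gamma\notin\Gamma_{od}$ and all $\theta\in\mathbb R_+^{\mathcal E}$. A direct rule $\pi$ is obedient if every $y\in\mathcal Y_{\Gamma}$ such that, for all $o,d\in\mathcal V$ and all $i,j\in\Gamma_{od}$, $y_{ij}^{od}=1$ if $i=j$ and $y_{ij}^{od}=0$ if $i\ne j$, is a solution of (P) for $\pi$ (with $\mathcal M=\Gamma$).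
   Formalization: Rules and path choices are normalised to sum 1 only for pairs (o,d) joined by a path (otherwise the sets are inconsistent); each delay τ_e(Θ_e,x) is assumed integrable for 0 ≤ x ≤ total throughput; rules are Borel measurable and equilibria coincide almost surely. *)

theory Defs
  imports "HOL-Probability.Probability" "Graph_Theory.Digraph"
begin

section \<open>Networks and paths\<close>

text \<open>
  Multigraphs are the records of Graph\_Theory: \<open>verts\<close>, \<open>arcs\<close>, \<open>tail\<close>, \<open>head\<close>.
  Only the tails along a path are required to be distinct, so the destination may be visited
  before the end; this is why \<open>apath\<close>, which forbids that, is not used. There are no paths
  from a node to itself.
\<close>

definition od_paths :: "('v, 'e) pre_digraph \<Rightarrow> 'v \<Rightarrow> 'v \<Rightarrow> 'e list set" where
  "od_paths G u v =
     {p. u \<noteq> v \<and> p \<noteq> [] \<and> set p \<subseteq> arcs G \<and> tail G (hd p) = u \<and> head G (last p) = v \<and>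
         (\<forall>i. Suc i < length p \<longrightarrow> head G (p ! i) = tail G (p ! Suc i)) \<and>
         distinct (map (tail G) p)}"

definition paths :: "('v, 'e) pre_digraph \<Rightarrow> 'e list set" where
  "paths G = (\<Union>u\<in>verts G. \<Union>v\<in>verts G. od_paths G u v)"

definition incidence :: "'e \<Rightarrow> 'e list \<Rightarrow> real" where
  "incidence e p = (if e \<in> set p then 1 else 0)"


section \<open>States, rules, path choices and flows\<close>

text \<open>
  Vectors indexed by the links are (extensional) functions on \<open>arcs G\<close>; the space of the
  following measurable space is the nonnegative orthant.
\<close>

definition state_space :: "('v, 'e) pre_digraph \<Rightarrow> ('e \<Rightarrow> real) measure" where
  "state_space G = PiM (arcs G) (\<lambda>_. restrict_space borel {0..})"

text \<open>
  A rule is written \<open>\<pi> \<theta> u v m\<close>. Normalisation is imposed on the pairs \<open>(u, v)\<close> that are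
  joined by a path: for the other pairs (in particular for \<open>u = v\<close>) there are no users, and it
  would be incompatible with directness below.
\<close>

definition rules ::
  "('v, 'e) pre_digraph \<Rightarrow> 'm set \<Rightarrow> (('e \<Rightarrow> real) \<Rightarrow> 'v \<Rightarrow> 'v \<Rightarrow> 'm \<Rightarrow> real) set" where
  "rules G Ms = {\<pi>. \<forall>u\<in>verts G. \<forall>v\<in>verts G.
     (\<forall>m\<in>Ms. (\<lambda>\<theta>. \<pi> \<theta> u v m) \<in> borel_measurable (state_space G)) \<and>
     (\<forall>\<theta>\<in>space (state_space G). (\<forall>m\<in>Ms. 0 \<le> \<pi> \<theta> u v m) \<and>
        (od_paths G u v \<noteq> {} \<longrightarrow> (\<Sum>m\<in>Ms. \<pi> \<theta> u v m) = 1))}"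

text \<open>
  The fraction of users from \<open>u\<close> to \<open>v\<close> choosing path \<open>p\<close> upon message \<open>m\<close> is \<open>y u v p m\<close>.
  When there is no path from \<open>u\<close> to \<open>v\<close> all these entries vanish, so their sum is not
  required to be 1.
\<close>

definition choices ::
  "('v, 'e) pre_digraph \<Rightarrow> 'm set \<Rightarrow> ('v \<Rightarrow> 'v \<Rightarrow> 'e list \<Rightarrow> 'm \<Rightarrow> real) set" where
  "choices G Ms = {y. \<forall>u\<in>verts G. \<forall>v\<in>verts G. \<forall>m\<in>Ms.
     (\<forall>p\<in>paths G. 0 \<le> y u v p m) \<and>
     (\<forall>p\<in>paths G - od_paths G u v. y u v p m = 0) \<and>
     (od_paths G u v \<noteq> {} \<longrightarrow> (\<Sum>p\<in>paths G. y u v p m) = 1)}"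

definition link_flow ::
  "('v, 'e) pre_digraph \<Rightarrow> ('v \<Rightarrow> 'v \<Rightarrow> real) \<Rightarrow> 'm set \<Rightarrow>
   (('e \<Rightarrow> real) \<Rightarrow> 'v \<Rightarrow> 'v \<Rightarrow> 'm \<Rightarrow> real) \<Rightarrow> ('v \<Rightarrow> 'v \<Rightarrow> 'e list \<Rightarrow> 'm \<Rightarrow> real) \<Rightarrow>
   ('e \<Rightarrow> real) \<Rightarrow> 'e \<Rightarrow> real" where
  "link_flow G \<upsilon> Ms \<pi> y \<theta> e =
     (\<Sum>u\<in>verts G. \<Sum>v\<in>verts G. \<Sum>p\<in>od_paths G u v.
        incidence e p * (\<Sum>m\<in>Ms. y u v p m * \<pi> \<theta> u v m * \<upsilon> u v))"


section \<open>Equilibria, cost and obedience\<close>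

text \<open>In this section \<open>P\<close> is the law of the network state, a measure on \<open>state_space G\<close>.\<close>

definition path_cost ::
  "('v, 'e) pre_digraph \<Rightarrow> ('e \<Rightarrow> real \<Rightarrow> real \<Rightarrow> real) \<Rightarrow> 'e list \<Rightarrow>
   ('e \<Rightarrow> real) \<Rightarrow> ('e \<Rightarrow> real) \<Rightarrow> real" where
  "path_cost G \<tau> p \<theta> x = (\<Sum>e\<in>arcs G. incidence e p * \<tau> e (\<theta> e) (x e))"

definition potential ::
  "('v, 'e) pre_digraph \<Rightarrow> ('v \<Rightarrow> 'v \<Rightarrow> real) \<Rightarrow> ('e \<Rightarrow> real \<Rightarrow> real \<Rightarrow> real) \<Rightarrow>
   ('e \<Rightarrow> real) measure \<Rightarrow> 'm set \<Rightarrow>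
   (('e \<Rightarrow> real) \<Rightarrow> 'v \<Rightarrow> 'v \<Rightarrow> 'm \<Rightarrow> real) \<Rightarrow> ('v \<Rightarrow> 'v \<Rightarrow> 'e list \<Rightarrow> 'm \<Rightarrow> real) \<Rightarrow> real" where
  "potential G \<upsilon> \<tau> P Ms \<pi> y =
     (\<integral>\<theta>. (\<Sum>e\<in>arcs G. LBINT s:{0..link_flow G \<upsilon> Ms \<pi> y \<theta> e}. \<tau> e (\<theta> e) s) \<partial>P)"

definition solves_P ::
  "('v, 'e) pre_digraph \<Rightarrow> ('v \<Rightarrow> 'v \<Rightarrow> real) \<Rightarrow> ('e \<Rightarrow> real \<Rightarrow> real \<Rightarrow> real) \<Rightarrow>
   ('e \<Rightarrow> real) measure \<Rightarrow> 'm set \<Rightarrow>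
   (('e \<Rightarrow> real) \<Rightarrow> 'v \<Rightarrow> 'v \<Rightarrow> 'm \<Rightarrow> real) \<Rightarrow> ('v \<Rightarrow> 'v \<Rightarrow> 'e list \<Rightarrow> 'm \<Rightarrow> real) \<Rightarrow> bool" where
  "solves_P G \<upsilon> \<tau> P Ms \<pi> y \<longleftrightarrow> is_arg_min (potential G \<upsilon> \<tau> P Ms \<pi>) (\<lambda>x. x \<in> choices G Ms) y"

definition is_bwe ::
  "('v, 'e) pre_digraph \<Rightarrow> ('v \<Rightarrow> 'v \<Rightarrow> real) \<Rightarrow> ('e \<Rightarrow> real \<Rightarrow> real \<Rightarrow> real) \<Rightarrow>
   ('e \<Rightarrow> real) measure \<Rightarrow> 'm set \<Rightarrow>
   (('e \<Rightarrow> real) \<Rightarrow> 'v \<Rightarrow> 'v \<Rightarrow> 'm \<Rightarrow> real) \<Rightarrow> (('e \<Rightarrow> real) \<Rightarrow> 'e \<Rightarrow> real) \<Rightarrow> bool" where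
  "is_bwe G \<upsilon> \<tau> P Ms \<pi> f \<longleftrightarrow>
     (\<exists>y\<in>choices G Ms.
        (\<forall>\<theta>\<in>space (state_space G). \<forall>e\<in>arcs G. f \<theta> e = link_flow G \<upsilon> Ms \<pi> y \<theta> e) \<and>
        (\<forall>u\<in>verts G. \<forall>v\<in>verts G. \<forall>i\<in>od_paths G u v. \<forall>m\<in>Ms. 0 < y u v i m \<longrightarrow>
           (\<forall>j\<in>od_paths G u v.
              (\<integral>\<theta>. (path_cost G \<tau> i \<theta> (f \<theta>) - path_cost G \<tau> j \<theta> (f \<theta>)) * \<pi> \<theta> u v m \<partial>P) \<le> 0)))"

definition system_cost ::
  "('v, 'e) pre_digraph \<Rightarrow> ('e \<Rightarrow> real \<Rightarrow> real \<Rightarrow> real) \<Rightarrow> 'w measure \<Rightarrow> ('w \<Rightarrow> 'e \<Rightarrow> real) \<Rightarrow>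
   (('e \<Rightarrow> real) \<Rightarrow> 'e \<Rightarrow> real) \<Rightarrow> real" where
  "system_cost G \<tau> \<Omega> \<Theta> f =
     (\<integral>\<omega>. (\<Sum>e\<in>arcs G. f (\<Theta> \<omega>) e * \<tau> e (\<Theta> \<omega> e) (f (\<Theta> \<omega>) e)) \<partial>\<Omega>)"

definition direct :: "('v, 'e) pre_digraph \<Rightarrow> (('e \<Rightarrow> real) \<Rightarrow> 'v \<Rightarrow> 'v \<Rightarrow> 'e list \<Rightarrow> real) \<Rightarrow> bool" where
  "direct G \<pi> \<longleftrightarrow> \<pi> \<in> rules G (paths G) \<and>
     (\<forall>u\<in>verts G. \<forall>v\<in>verts G. \<forall>p\<in>paths G - od_paths G u v. \<forall>\<theta>\<in>space (state_space G).
        \<pi> \<theta> u v p = 0)"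

definition obedient ::
  "('v, 'e) pre_digraph \<Rightarrow> ('v \<Rightarrow> 'v \<Rightarrow> real) \<Rightarrow> ('e \<Rightarrow> real \<Rightarrow> real \<Rightarrow> real) \<Rightarrow>
   ('e \<Rightarrow> real) measure \<Rightarrow> (('e \<Rightarrow> real) \<Rightarrow> 'v \<Rightarrow> 'v \<Rightarrow> 'e list \<Rightarrow> real) \<Rightarrow> bool" where
  "obedient G \<upsilon> \<tau> P \<pi> \<longleftrightarrow>
     direct G \<pi> \<and>
     (\<forall>y\<in>choices G (paths G).
        (\<forall>u\<in>verts G. \<forall>v\<in>verts G. \<forall>i\<in>od_paths G u v. \<forall>j\<in>od_paths G u v.
           y u v i j = (if i = j then 1 else 0)) \<longrightarrow>
        solves_P G \<upsilon> \<tau> P (paths G) \<pi> y)"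


section \<open>Standing assumptions\<close>

text \<open>
  The last assumption makes the potential, the equilibrium inequalities and the system cost
  integrals of integrable functions: no link flow exceeds the total throughput, and delays
  increase with the flow.
\<close>

locale stochastic_network =
  fin_digraph G + loopfree_digraph G + prob_space \<Omega> + complete_measure \<Omega>
  for G :: "('v, 'e) pre_digraph" and \<Omega> :: "'w measure" +
  fixes \<upsilon> :: "'v \<Rightarrow> 'v \<Rightarrow> real"
    and \<Theta> :: "'w \<Rightarrow> 'e \<Rightarrow> real"
    and \<tau> :: "'e \<Rightarrow> real \<Rightarrow> real \<Rightarrow> real"
  assumes verts_nonempty: "verts G \<noteq> {}"
    and throughput_nonneg: "\<And>u v. u \<in> verts G \<Longrightarrow> v \<in> verts G \<Longrightarrow> 0 \<le> \<upsilon> u v"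
    and throughput_diag: "\<And>u. u \<in> verts G \<Longrightarrow> \<upsilon> u u = 0"
    and throughput_unreachable:
      "\<And>u v. u \<in> verts G \<Longrightarrow> v \<in> verts G \<Longrightarrow> od_paths G u v = {} \<Longrightarrow> \<upsilon> u v = 0"
    and state_measurable: "\<Theta> \<in> measurable \<Omega> (state_space G)"
    and state_first_moment: "\<And>e. e \<in> arcs G \<Longrightarrow> integrable \<Omega> (\<lambda>\<omega>. \<Theta> \<omega> e)"
    and state_second_moment: "\<And>e. e \<in> arcs G \<Longrightarrow> integrable \<Omega> (\<lambda>\<omega>. (\<Theta> \<omega> e)\<^sup>2)"
    and delay_nonneg: "\<And>e t x. e \<in> arcs G \<Longrightarrow> 0 \<le> t \<Longrightarrow> 0 \<le> x \<Longrightarrow> 0 \<le> \<tau> e t x"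
    and delay_measurable: "\<And>e. e \<in> arcs G \<Longrightarrow>
      (\<lambda>(t, x). \<tau> e t x) \<in> borel_measurable (restrict_space borel ({0..} \<times> {0..}))"
    and delay_C1: "\<And>e t. e \<in> arcs G \<Longrightarrow> 0 \<le> t \<Longrightarrow>
      \<exists>\<tau>'. continuous_on {0..} \<tau>' \<and>
           (\<forall>x\<ge>0. (\<tau> e t has_real_derivative \<tau>' x) (at x within {0..}))"
    and delay_strict_mono: "\<And>e t. e \<in> arcs G \<Longrightarrow> 0 \<le> t \<Longrightarrow> strict_mono_on {0..} (\<tau> e t)"
    and delay_convex: "\<And>e t. e \<in> arcs G \<Longrightarrow> 0 \<le> t \<Longrightarrow> convex_on {0..} (\<tau> e t)"
    and delay_integrable: "\<And>e x. e \<in> arcs G \<Longrightarrow> 0 \<le> x \<Longrightarrow>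
      x \<le> (\<Sum>u\<in>verts G. \<Sum>v\<in>verts G. \<upsilon> u v) \<Longrightarrow> integrable \<Omega> (\<lambda>\<omega>. \<tau> e (\<Theta> \<omega> e) x)"

end

theory Submission
  imports Defs
begin

text \<open>
  Let \<open>\<pi>'\<close> be the direct rule. A choice \<open>x\<close> among path recommendations, applied after \<open>y\<close>, is the
  choice \<open>compose_choices G x y\<close> among the original messages and induces the same flow. So the
  flows available under \<open>\<pi>'\<close> are among those available under \<open>\<pi>\<close>, and obeying reproduces the
  flow \<open>h\<close> of the minimiser \<open>y\<close>: hence \<open>\<pi>'\<close> is obedient. Differentiating the convex potential,
  minimisers satisfy a variational inequality whose integrand splits into path costs, and
  equilibria are the flows satisfying it; strict monotonicity of the delays makes such flows
  almost surely unique for each rule. Being an equilibrium of both rules, \<open>h\<close> agrees with every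
  equilibrium of either.
\<close>

section \<open>Finite sums over paths, choices and link flows\<close>

text \<open>Meant for nested conditionals on several summation indices: a condition on an outer
  index is pulled out of the inner sum, which then collapses by \<open>sum.delta\<close>.\<close>

lemma sum_if_const: "(\<Sum>x\<in>A. if c then f x else 0) = (if c then sum f A else 0)"
  by simp

lemma od_paths_subset:
  assumes "u \<in> verts G" "v \<in> verts G"
  shows "od_paths G u v \<subseteq> paths G"
  using assms unfolding paths_def by blast

lemma finite_od_paths:
  assumes "finite (arcs G)"
  shows "finite (od_paths G u v)"
proof (rule finite_subset)
  show "od_paths G u v \<subseteq> {p. set p \<subseteq> arcs G \<and> distinct p}"
    by (auto simp: od_paths_def distinct_map)
qed (rule finite_subset_distinct[OF assms])

lemma choices_sum:
  assumes "y \<in> choices G Ms" "finite (paths G)" "u \<in> verts G" "v \<in> verts G" "m \<in> Ms"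
  shows "(\<Sum>p\<in>od_paths G u v. y u v p m) = (if od_paths G u v = {} then 0 else 1)"
proof -
  have "(\<Sum>p\<in>od_paths G u v. y u v p m) = (\<Sum>p\<in>paths G. y u v p m)"
    using assms by (intro sum.mono_neutral_left) (auto simp: choices_def od_paths_subset)
  then show ?thesis
    using assms by (auto simp: choices_def)
qed

lemma choices_nonneg:
  assumes "y \<in> choices G Ms" "u \<in> verts G" "v \<in> verts G" "m \<in> Ms" "p \<in> od_paths G u v"
  shows "0 \<le> y u v p m"
  using assms od_paths_subset[of u G v] by (auto simp: choices_def)

text \<open>Interchanging the finite sums trades link weights for path weights: the weights
  \<open>a\<close> are totalled along each path. With delays as weights this total is the path cost,
  which is how link quantities become path quantities.\<close>

lemma sum_mult_link_flow:
  "(\<Sum>e\<in>E. a e * link_flow G \<upsilon> Ms \<pi> y \<theta> e) =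
    (\<Sum>u\<in>verts G. \<Sum>v\<in>verts G. \<Sum>m\<in>Ms. \<Sum>p\<in>od_paths G u v.
       \<upsilon> u v * y u v p m * ((\<Sum>e\<in>E. incidence e p * a e) * \<pi> \<theta> u v m))"
proof -
  have "(\<Sum>e\<in>E. a e * link_flow G \<upsilon> Ms \<pi> y \<theta> e) =
    (\<Sum>e\<in>E. \<Sum>u\<in>verts G. \<Sum>v\<in>verts G. \<Sum>p\<in>od_paths G u v. \<Sum>m\<in>Ms.
       \<upsilon> u v * y u v p m * (incidence e p * a e * \<pi> \<theta> u v m))"
    by (simp add: link_flow_def sum_distrib_left mult_ac)
  also have "\<dots> = (\<Sum>u\<in>verts G. \<Sum>v\<in>verts G. \<Sum>p\<in>od_paths G u v. \<Sum>m\<in>Ms. \<Sum>e\<in>E.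
       \<upsilon> u v * y u v p m * (incidence e p * a e * \<pi> \<theta> u v m))"
    by (simp only: sum.swap[of _ _ E])
  also have "\<dots> = (\<Sum>u\<in>verts G. \<Sum>v\<in>verts G. \<Sum>m\<in>Ms. \<Sum>p\<in>od_paths G u v. \<Sum>e\<in>E.
       \<upsilon> u v * y u v p m * (incidence e p * a e * \<pi> \<theta> u v m))"
    by (intro sum.cong refl sum.swap)
  finally show ?thesis
    by (simp add: sum_distrib_left sum_distrib_right)
qed

lemma link_flow_eq:
  "link_flow G \<upsilon> Ms \<pi> y \<theta> e =
    (\<Sum>u\<in>verts G. \<Sum>v\<in>verts G. \<Sum>m\<in>Ms. \<Sum>p\<in>od_paths G u v.
       \<upsilon> u v * y u v p m * (incidence e p * \<pi> \<theta> u v m))"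
  using sum_mult_link_flow[of "\<lambda>_. 1" G \<upsilon> Ms \<pi> y \<theta> "{e}"] by simp

text \<open>The flow is linear in the choice. The segment is written as a step of size
  \<open>t\<close> from \<open>y\<close> towards \<open>x\<close>, the form in which the potential
  is varied later.\<close>

lemma link_flow_convex:
  "link_flow G \<upsilon> Ms \<pi> (\<lambda>u v p m. y u v p m + t * (x u v p m - y u v p m)) \<theta> e =
    link_flow G \<upsilon> Ms \<pi> y \<theta> e + t * (link_flow G \<upsilon> Ms \<pi> x \<theta> e - link_flow G \<upsilon> Ms \<pi> y \<theta> e)"
  unfolding link_flow_eq sum_distrib_left sum_subtractf[symmetric] sum.distrib[symmetric]
  by (intro sum.cong refl) (simp add: algebra_simps)

lemma choices_convex:
  assumes "x \<in> choices G Ms" "y \<in> choices G Ms" "0 \<le> t" "t \<le> 1"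
  shows "(\<lambda>u v p m. y u v p m + t * (x u v p m - y u v p m)) \<in> choices G Ms"
  unfolding choices_def
proof (intro CollectI ballI conjI impI)
  fix u v m p assume *: "u \<in> verts G" "v \<in> verts G" "m \<in> Ms"
  { assume "p \<in> paths G"
    then have "0 \<le> (1 - t) * y u v p m + t * x u v p m"
      using assms * by (simp add: choices_def)
    then show "0 \<le> y u v p m + t * (x u v p m - y u v p m)"
      by (simp add: algebra_simps) }
  { assume "p \<in> paths G - od_paths G u v"
    then show "y u v p m + t * (x u v p m - y u v p m) = 0"
      using assms * by (simp add: choices_def) }
  { assume "od_paths G u v \<noteq> {}"
    then show "(\<Sum>p\<in>paths G. y u v p m + t * (x u v p m - y u v p m)) = 1"
      using assms *
      by (simp add: choices_def sum.distrib sum_subtractf sum_distrib_left[symmetric]) }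
qed

section \<open>Composition of choices and the obedient choice\<close>

text \<open>The product of two stochastic kernels: \<open>y\<close> turns the message
  \<open>m\<close> into a recommended path \<open>q\<close>, and \<open>x\<close> turns
  \<open>q\<close> into the path \<open>p\<close> that is travelled.\<close>

definition compose_choices ::
  "('v, 'e) pre_digraph \<Rightarrow> ('v \<Rightarrow> 'v \<Rightarrow> 'e list \<Rightarrow> 'e list \<Rightarrow> real) \<Rightarrow>
   ('v \<Rightarrow> 'v \<Rightarrow> 'e list \<Rightarrow> 'm \<Rightarrow> real) \<Rightarrow> 'v \<Rightarrow> 'v \<Rightarrow> 'e list \<Rightarrow> 'm \<Rightarrow> real" where
  "compose_choices G x y u v p m = (\<Sum>q\<in>paths G. x u v p q * y u v q m)"

lemma compose_choices_in_choices:
  assumes x: "x \<in> choices G (paths G)" and y: "y \<in> choices G Ms"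
  shows "compose_choices G x y \<in> choices G Ms"
  unfolding choices_def
proof (intro CollectI ballI conjI impI)
  fix u v m p assume *: "u \<in> verts G" "v \<in> verts G" "m \<in> Ms"
  { assume "p \<in> paths G"
    then show "0 \<le> compose_choices G x y u v p m"
      using x y * by (auto simp: compose_choices_def choices_def intro!: sum_nonneg) }
  { assume "p \<in> paths G - od_paths G u v"
    then show "compose_choices G x y u v p m = 0"
      using x y * by (auto simp: compose_choices_def choices_def intro!: sum.neutral) }
  { assume ne: "od_paths G u v \<noteq> {}"
    have "(\<Sum>p\<in>paths G. compose_choices G x y u v p m) =
        (\<Sum>q\<in>paths G. (\<Sum>p\<in>paths G. x u v p q) * y u v q m)"
      unfolding compose_choices_def by (subst sum.swap) (simp add: sum_distrib_right)
    also have "\<dots> = 1"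
      using x y * ne by (simp add: choices_def)
    finally show "(\<Sum>p\<in>paths G. compose_choices G x y u v p m) = 1" . }
qed

text \<open>Associativity of composing kernels, \<open>\<pi>'\<close> being itself
  \<open>\<pi>\<close> followed by \<open>y\<close>. The hypothesis concerns the one state
  \<open>\<theta>\<close>, since the direct rule is prescribed only on the state space.\<close>

lemma link_flow_compose:
  assumes "\<And>u v q. u \<in> verts G \<Longrightarrow> v \<in> verts G \<Longrightarrow> q \<in> paths G \<Longrightarrow>
      \<pi>' \<theta> u v q = (\<Sum>m\<in>Ms. y u v q m * \<pi> \<theta> u v m)"
  shows "link_flow G \<upsilon> (paths G) \<pi>' x \<theta> e = link_flow G \<upsilon> Ms \<pi> (compose_choices G x y) \<theta> e"
  unfolding link_flow_def
proof (intro sum.cong refl arg_cong2[where f = "(*)"])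
  fix u v p assume *: "u \<in> verts G" "v \<in> verts G"
  have "(\<Sum>q\<in>paths G. x u v p q * \<pi>' \<theta> u v q * \<upsilon> u v) =
      (\<Sum>q\<in>paths G. \<Sum>m\<in>Ms. x u v p q * y u v q m * \<pi> \<theta> u v m * \<upsilon> u v)"
    using assms * by (simp add: sum_distrib_left sum_distrib_right mult_ac)
  also have "\<dots> = (\<Sum>m\<in>Ms. compose_choices G x y u v p m * \<pi> \<theta> u v m * \<upsilon> u v)"
    by (subst sum.swap) (simp add: compose_choices_def sum_distrib_left sum_distrib_right mult_ac)
  finally show "(\<Sum>q\<in>paths G. x u v p q * \<pi>' \<theta> u v q * \<upsilon> u v) = \<dots>" .
qed

text \<open>Off \<open>od_paths G u v\<close> the obedient choice is arbitrary, since a direct rule never sends such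
  a message; it only has to be a probability distribution.\<close>

definition obedient_choice ::
  "('v, 'e) pre_digraph \<Rightarrow> 'v \<Rightarrow> 'v \<Rightarrow> 'e list \<Rightarrow> 'e list \<Rightarrow> real" where
  "obedient_choice G u v p q =
    (if p \<in> od_paths G u v \<and>
        p = (if q \<in> od_paths G u v then q else (SOME r. r \<in> od_paths G u v)) then 1 else 0)"

lemma obedient_choice_in_choices:
  assumes "finite (paths G)"
  shows "obedient_choice G \<in> choices G (paths G)"
  unfolding choices_def
proof (intro CollectI ballI conjI impI)
  fix u v q assume *: "u \<in> verts G" "v \<in> verts G" and ne: "od_paths G u v \<noteq> {}"
  define r where "r = (if q \<in> od_paths G u v then q else (SOME r. r \<in> od_paths G u v))"
  have r: "r \<in> od_paths G u v"
    using ne by (auto simp: r_def some_in_eq)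
  then have "obedient_choice G u v p q = (if p = r then 1 else 0)" for p
    by (auto simp: obedient_choice_def r_def)
  then show "(\<Sum>p\<in>paths G. obedient_choice G u v p q) = 1"
    using assms r od_paths_subset[OF *] by (auto simp: subset_eq)
qed (auto simp: obedient_choice_def)

text \<open>\<open>y\<close> gives no mass to a recommendation outside
  \<open>od_paths G u v\<close>, so the sum meets only entries at which \<open>x\<close> acts as the
  identity.\<close>

lemma compose_identity:
  assumes "y \<in> choices G Ms" "finite (paths G)"
    and "\<And>u v i j. u \<in> verts G \<Longrightarrow> v \<in> verts G \<Longrightarrow> i \<in> od_paths G u v \<Longrightarrow> j \<in> od_paths G u v \<Longrightarrow>
        x u v i j = (if i = j then 1 else 0)"
    and "u \<in> verts G" "v \<in> verts G" "m \<in> Ms" "p \<in> od_paths G u v"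
  shows "compose_choices G x y u v p m = y u v p m"
proof -
  have "compose_choices G x y u v p m = (\<Sum>q\<in>od_paths G u v. x u v p q * y u v q m)"
    unfolding compose_choices_def using assms
    by (intro sum.mono_neutral_right) (auto simp: choices_def od_paths_subset)
  also have "\<dots> = (\<Sum>q\<in>od_paths G u v. if p = q then y u v q m else 0)"
    using assms by (intro sum.cong) auto
  also have "\<dots> = y u v p m"
    using assms(7) finite_subset[OF od_paths_subset[OF assms(4,5)] assms(2)] by simp
  finally show ?thesis .
qed

text \<open>Comparing the choices after multiplication by the throughput lets them differ on pairs
  without users.\<close>

lemma link_flow_cong:
  assumes "\<And>u v p m. u \<in> verts G \<Longrightarrow> v \<in> verts G \<Longrightarrow> m \<in> Ms \<Longrightarrow> p \<in> od_paths G u v \<Longrightarrow>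
    \<upsilon> u v * x u v p m = \<upsilon> u v * y u v p m"
  shows "link_flow G \<upsilon> Ms \<pi> x \<theta> e = link_flow G \<upsilon> Ms \<pi> y \<theta> e"
  unfolding link_flow_eq by (intro sum.cong refl) (simp add: assms)

section \<open>Measurability, monotonicity and integrability of delays\<close>

context stochastic_network
begin

abbreviation law :: "('e \<Rightarrow> real) measure" where
  "law \<equiv> distr \<Omega> (state_space G) \<Theta>"

abbreviation demand :: real where
  "demand \<equiv> (\<Sum>u\<in>verts G. \<Sum>v\<in>verts G. \<upsilon> u v)"

abbreviation delay_integral :: "'e \<Rightarrow> real \<Rightarrow> real \<Rightarrow> real" where
  "delay_integral e t x \<equiv> (LBINT s:{0..x}. \<tau> e t s)"

lemma finite_od [simp]: "finite (od_paths G u v)"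
  by (simp add: finite_od_paths)

lemma finite_paths [simp]: "finite (paths G)"
  by (simp add: paths_def)

lemma demand_nonneg: "0 \<le> demand"
  by (intro sum_nonneg throughput_nonneg)

lemma state_nonneg: "\<theta> \<in> space (state_space G) \<Longrightarrow> e \<in> arcs G \<Longrightarrow> 0 \<le> \<theta> e"
  by (auto simp: state_space_def space_PiM space_restrict_space PiE_def Pi_def)

lemma state_component_measurable:
  assumes "e \<in> arcs G"
  shows "(\<lambda>\<theta>. \<theta> e) \<in> borel_measurable (state_space G)"
  using measurable_component_singleton[OF assms, of "\<lambda>_. restrict_space borel {0..}"]
  unfolding state_space_def measurable_restrict_space2_iff by blast

text \<open>Joint measurability of the delay is available on the quadrant, so the pair of arguments
  is first made measurable into the restricted space.\<close>

lemma delay_compose_measurable: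
  assumes "e \<in> arcs G" and [measurable]: "a \<in> borel_measurable M" "b \<in> borel_measurable M"
    and "\<And>x. x \<in> space M \<Longrightarrow> 0 \<le> a x" "\<And>x. x \<in> space M \<Longrightarrow> 0 \<le> b x"
  shows "(\<lambda>x. \<tau> e (a x) (b x)) \<in> borel_measurable M"
proof -
  have "(\<lambda>x. (a x, b x)) \<in> measurable M (borel :: (real \<times> real) measure)"
    by measurable
  then have "(\<lambda>x. (a x, b x)) \<in> measurable M (restrict_space borel ({0..} \<times> {0..}))"
    using assms by (intro measurable_restrict_space2) auto
  from measurable_compose[OF this delay_measurable[OF assms(1)]] show ?thesis
    by simp
qed

lemma delay_mono:
  assumes "e \<in> arcs G" "0 \<le> t" "0 \<le> x" "x \<le> x'"
  shows "\<tau> e t x \<le> \<tau> e t x'"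
  using strict_mono_onD[OF delay_strict_mono[OF assms(1,2)], of x x'] assms
  by (cases "x = x'") auto

lemma delay_continuous:
  assumes "e \<in> arcs G" "0 \<le> t"
  shows "continuous_on {0..} (\<tau> e t)"
  using delay_C1[OF assms] by (auto intro: DERIV_continuous_on)

text \<open>The subgradient inequality for the primitive of the delay, with the slope at
  \<open>z\<close>. Between \<open>x\<close> and \<open>z\<close> the increasing delay lies below
  its value at \<open>z\<close> if \<open>x \<le> z\<close> and above it otherwise; in the second
  case the reversed orientation restores the direction of the inequality.\<close>

lemma delay_integral_diff_le:
  assumes e: "e \<in> arcs G" and t: "0 \<le> t" and "0 \<le> x" "0 \<le> z"
  shows "delay_integral e t z - delay_integral e t x \<le> \<tau> e t z * (z - x)"
proof -
  have cont: "continuous_on {a..b} (\<tau> e t)" if "0 \<le> a" for a b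
    using continuous_on_subset[OF delay_continuous[OF e t]] that by auto
  \<comment> \<open>The gauge integral gives access to \<open>integral_combine\<close>.\<close>
  have eq: "delay_integral e t b = integral {0..b} (\<tau> e t)" for b
    by (intro set_borel_integral_eq_integral borel_integrable_atLeastAtMost' cont) simp
  have comb: "integral {0..a} (\<tau> e t) + integral {a..b} (\<tau> e t) = integral {0..b} (\<tau> e t)"
    if "0 \<le> a" "a \<le> b" for a b
    using that by (intro Henstock_Kurzweil_Integration.integral_combine integrable_continuous_interval cont) auto
  show ?thesis
  proof (cases "x \<le> z")
    case True
    have "integral {x..z} (\<tau> e t) \<le> integral {x..z} (\<lambda>_. \<tau> e t z)"
      using assms by (intro integral_le integrable_continuous_interval cont)
        (auto intro: delay_mono)
    then show ?thesis
      using comb[of x z] True assms by (simp add: eq mult.commute)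
  next
    case False
    have "integral {z..x} (\<lambda>_. \<tau> e t z) \<le> integral {z..x} (\<tau> e t)"
      using assms by (intro integral_le integrable_continuous_interval cont)
        (auto intro: delay_mono)
    then show ?thesis
      using comb[of z x] False assms by (simp add: eq algebra_simps)
  qed
qed

text \<open>Both bounds are the subgradient inequality between \<open>0\<close> and
  \<open>x\<close>: with the slope at \<open>0\<close> for the lower one, with the slope at
  \<open>x\<close> for the upper one.\<close>

lemma delay_integral_bounds:
  assumes "e \<in> arcs G" "0 \<le> t" "0 \<le> x"
  shows "0 \<le> delay_integral e t x" "delay_integral e t x \<le> x * \<tau> e t x"
proof -
  have 0: "delay_integral e t 0 = 0"
    using set_borel_integral_eq_integral(2)[OF borel_integrable_atLeastAtMost', of 0 0 "\<tau> e t"] by simp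
  show "0 \<le> delay_integral e t x"
    using delay_integral_diff_le[of e t x 0] assms 0
      mult_nonneg_nonneg[OF delay_nonneg[of e t 0], of x] by simp
  show "delay_integral e t x \<le> x * \<tau> e t x"
    using delay_integral_diff_le[of e t 0 x] assms 0 by (simp add: mult.commute)
qed

lemma integrable_delay_demand:
  assumes e: "e \<in> arcs G"
  shows "integrable law (\<lambda>\<theta>. \<tau> e (\<theta> e) demand)"
proof (subst integrable_distr_eq[OF state_measurable])
  show "(\<lambda>\<theta>. \<tau> e (\<theta> e) demand) \<in> borel_measurable (state_space G)"
    using e by (intro delay_compose_measurable state_component_measurable)
      (auto simp: state_nonneg demand_nonneg)
  show "integrable \<Omega> (\<lambda>\<omega>. \<tau> e (\<Theta> \<omega> e) demand)"
    using e by (intro delay_integrable demand_nonneg) auto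
qed

text \<open>Since the delay increases and \<open>a\<close> stays below \<open>demand\<close>, the
  product is dominated by the integrable delay at \<open>demand\<close> times the constant
  \<open>B\<close>.\<close>

lemma integrable_delay:
  assumes e: "e \<in> arcs G"
    and a: "a \<in> borel_measurable (state_space G)"
      "\<And>\<theta>. \<theta> \<in> space (state_space G) \<Longrightarrow> 0 \<le> a \<theta> \<and> a \<theta> \<le> demand"
    and b: "b \<in> borel_measurable (state_space G)"
      "\<And>\<theta>. \<theta> \<in> space (state_space G) \<Longrightarrow> \<bar>b \<theta>\<bar> \<le> B"
  shows "integrable law (\<lambda>\<theta>. \<tau> e (\<theta> e) (a \<theta>) * b \<theta>)"
proof (rule Bochner_Integration.integrable_bound)
  show "integrable law (\<lambda>\<theta>. \<tau> e (\<theta> e) demand * B)"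
    using integrable_delay_demand[OF e] by simp
  have "(\<lambda>\<theta>. \<tau> e (\<theta> e) (a \<theta>)) \<in> borel_measurable (state_space G)"
    using e a by (intro delay_compose_measurable state_component_measurable)
      (auto simp: state_nonneg)
  with b(1) show "(\<lambda>\<theta>. \<tau> e (\<theta> e) (a \<theta>) * b \<theta>) \<in> borel_measurable law"
    by simp
  show "AE \<theta> in law. norm (\<tau> e (\<theta> e) (a \<theta>) * b \<theta>) \<le> norm (\<tau> e (\<theta> e) demand * B)"
  proof (rule AE_I2)
    fix \<theta> assume "\<theta> \<in> space law"
    then have th: "\<theta> \<in> space (state_space G)"
      by simp
    note nn = state_nonneg[OF th e]
    have "\<bar>\<tau> e (\<theta> e) (a \<theta>)\<bar> \<le> \<bar>\<tau> e (\<theta> e) demand\<bar>"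
      using delay_mono[OF e nn, of "a \<theta>" demand] delay_nonneg[OF e nn, of "a \<theta>"] a(2)[OF th] by simp
    moreover have "\<bar>b \<theta>\<bar> \<le> \<bar>B\<bar>"
      using b(2)[OF th] by simp
    ultimately show "norm (\<tau> e (\<theta> e) (a \<theta>) * b \<theta>) \<le> norm (\<tau> e (\<theta> e) demand * B)"
      by (simp add: abs_mult mult_mono)
  qed
qed

lemma integrable_delay_integral:
  assumes e: "e \<in> arcs G"
    and a: "a \<in> borel_measurable (state_space G)"
      "\<And>\<theta>. \<theta> \<in> space (state_space G) \<Longrightarrow> 0 \<le> a \<theta> \<and> a \<theta> \<le> demand"
  shows "integrable law (\<lambda>\<theta>. delay_integral e (\<theta> e) (a \<theta>))"
proof (rule Bochner_Integration.integrable_bound)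
  show "integrable law (\<lambda>\<theta>. \<tau> e (\<theta> e) (a \<theta>) * a \<theta>)"
    using a by (intro integrable_delay[OF e, where B = demand]) auto
  \<comment> \<open>The domain of integration depends on \<open>\<theta>\<close>. Moving it into the
    integrand gives an integral over the whole line, measurable in its parameter;
    \<open>max 0 s\<close> keeps the argument of the delay in the quadrant.\<close>
  have eq: "delay_integral e (\<theta> e) (a \<theta>) =
      (\<integral>s. (if 0 \<le> s \<and> s \<le> a \<theta> then \<tau> e (\<theta> e) (max 0 s) else 0) \<partial>lborel)" for \<theta>
    unfolding set_lebesgue_integral_def
    by (intro Bochner_Integration.integral_cong) (auto simp: indicator_def max_def)
  note [measurable] = a(1) state_component_measurable[OF e]
  have [measurable]: "(\<lambda>(\<theta>, s). \<tau> e (\<theta> e) (max 0 s)) \<in> borel_measurable (state_space G \<Otimes>\<^sub>M lborel)"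
    unfolding split_beta
    using measurable_compose[OF measurable_fst state_component_measurable[OF e], of lborel]
    by (intro delay_compose_measurable e) (auto simp: space_pair_measure state_nonneg[OF _ e])
  show "(\<lambda>\<theta>. delay_integral e (\<theta> e) (a \<theta>)) \<in> borel_measurable law"
    unfolding eq by measurable
  show "AE \<theta> in law. norm (delay_integral e (\<theta> e) (a \<theta>)) \<le> norm (\<tau> e (\<theta> e) (a \<theta>) * a \<theta>)"
  proof (rule AE_I2)
    fix \<theta> assume "\<theta> \<in> space law"
    then have th: "\<theta> \<in> space (state_space G)"
      by simp
    show "norm (delay_integral e (\<theta> e) (a \<theta>)) \<le> norm (\<tau> e (\<theta> e) (a \<theta>) * a \<theta>)"
      using delay_integral_bounds[OF e state_nonneg[OF th e], of "a \<theta>"] a(2)[OF th]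
      by (simp add: mult.commute)
  qed
qed

end

section \<open>Signaling rules and bounds on the induced flows\<close>

locale signaling = stochastic_network G \<Omega> \<upsilon> \<Theta> \<tau>
  for G :: "('v, 'e) pre_digraph" and \<Omega> :: "'w measure" and \<upsilon> \<Theta> \<tau> +
  fixes Ms :: "'m set" and \<pi> :: "('e \<Rightarrow> real) \<Rightarrow> 'v \<Rightarrow> 'v \<Rightarrow> 'm \<Rightarrow> real"
  assumes finite_messages [simp]: "finite Ms"
    and rule: "\<pi> \<in> rules G Ms"
begin

abbreviation flow :: "('v \<Rightarrow> 'v \<Rightarrow> 'e list \<Rightarrow> 'm \<Rightarrow> real) \<Rightarrow> ('e \<Rightarrow> real) \<Rightarrow> 'e \<Rightarrow> real" where
  "flow \<equiv> link_flow G \<upsilon> Ms \<pi>"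

abbreviation \<Phi> :: "('v \<Rightarrow> 'v \<Rightarrow> 'e list \<Rightarrow> 'm \<Rightarrow> real) \<Rightarrow> real" where
  "\<Phi> \<equiv> potential G \<upsilon> \<tau> law Ms \<pi>"

lemma rule_measurable:
  "u \<in> verts G \<Longrightarrow> v \<in> verts G \<Longrightarrow> m \<in> Ms \<Longrightarrow>
    (\<lambda>\<theta>. \<pi> \<theta> u v m) \<in> borel_measurable (state_space G)"
  using rule by (simp add: rules_def)

lemma rule_nonneg:
  "\<theta> \<in> space (state_space G) \<Longrightarrow> u \<in> verts G \<Longrightarrow> v \<in> verts G \<Longrightarrow> m \<in> Ms \<Longrightarrow> 0 \<le> \<pi> \<theta> u v m"
  using rule by (simp add: rules_def)

lemma rule_sum:
  "\<theta> \<in> space (state_space G) \<Longrightarrow> u \<in> verts G \<Longrightarrow> v \<in> verts G \<Longrightarrow> od_paths G u v \<noteq> {} \<Longrightarrow>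
    (\<Sum>m\<in>Ms. \<pi> \<theta> u v m) = 1"
  using rule by (simp add: rules_def)

lemma rule_le_1:
  assumes "\<theta> \<in> space (state_space G)" "u \<in> verts G" "v \<in> verts G" "m \<in> Ms" "od_paths G u v \<noteq> {}"
  shows "\<pi> \<theta> u v m \<le> 1"
proof -
  have "\<pi> \<theta> u v m \<le> (\<Sum>m\<in>Ms. \<pi> \<theta> u v m)"
    using assms by (intro member_le_sum) (auto simp: rule_nonneg)
  then show ?thesis
    using rule_sum assms by simp
qed

lemma flow_measurable: "(\<lambda>\<theta>. flow y \<theta> e) \<in> borel_measurable (state_space G)"
  unfolding link_flow_eq
  by (intro borel_measurable_sum borel_measurable_times borel_measurable_const rule_measurable)

text \<open>For the upper bound the incidence is replaced by 1; then the choice and the rule sum out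
  and leave the throughput of each pair.\<close>

lemma flow_bounds:
  assumes y: "y \<in> choices G Ms" and th: "\<theta> \<in> space (state_space G)"
  shows "0 \<le> flow y \<theta> e" "flow y \<theta> e \<le> demand"
proof -
  show "0 \<le> flow y \<theta> e"
    unfolding link_flow_eq using th choices_nonneg[OF y]
    by (intro sum_nonneg mult_nonneg_nonneg) (auto simp: throughput_nonneg rule_nonneg incidence_def)
  show "flow y \<theta> e \<le> demand"
    unfolding link_flow_eq
  proof (intro sum_mono)
    fix u v assume *: "u \<in> verts G" "v \<in> verts G"
    have "(\<Sum>m\<in>Ms. \<Sum>p\<in>od_paths G u v. \<upsilon> u v * y u v p m * (incidence e p * \<pi> \<theta> u v m)) \<le>
        (\<Sum>m\<in>Ms. \<Sum>p\<in>od_paths G u v. \<upsilon> u v * y u v p m * (1 * \<pi> \<theta> u v m))"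
      using th * choices_nonneg[OF y]
      by (intro sum_mono mult_left_mono mult_right_mono mult_nonneg_nonneg)
        (auto simp: throughput_nonneg rule_nonneg incidence_def)
    also have "\<dots> = (\<Sum>m\<in>Ms. \<upsilon> u v * (\<Sum>p\<in>od_paths G u v. y u v p m) * \<pi> \<theta> u v m)"
      by (simp add: sum_distrib_left sum_distrib_right)
    \<comment> \<open>Without a path the choice sums to 0 instead of 1, but then the throughput
      vanishes as well.\<close>
    also have "\<dots> = (\<Sum>m\<in>Ms. \<upsilon> u v * \<pi> \<theta> u v m)"
      using * throughput_unreachable[OF *] by (simp add: choices_sum[OF y])
    also have "\<dots> = \<upsilon> u v"
      using rule_sum[OF th *] throughput_unreachable[OF *]
      by (cases "od_paths G u v = {}") (simp_all add: sum_distrib_left[symmetric])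
    finally show "(\<Sum>m\<in>Ms. \<Sum>p\<in>od_paths G u v.
        \<upsilon> u v * y u v p m * (incidence e p * \<pi> \<theta> u v m)) \<le> \<upsilon> u v" .
  qed
qed

section \<open>Path costs and the first variation of the potential\<close>

lemma integrable_delay_flow:
  assumes "e \<in> arcs G" "y \<in> choices G Ms"
    and "b \<in> borel_measurable (state_space G)"
    and "\<And>\<theta>. \<theta> \<in> space (state_space G) \<Longrightarrow> \<bar>b \<theta>\<bar> \<le> B"
  shows "integrable law (\<lambda>\<theta>. \<tau> e (\<theta> e) (flow y \<theta> e) * b \<theta>)"
  using assms by (intro integrable_delay[where B = B]) (auto simp: flow_measurable flow_bounds)

text \<open>\<open>variation x w\<close> is the derivative of the potential at \<open>x\<close> in the direction \<open>w - x\<close>.\<close>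

definition variation ::
  "('v \<Rightarrow> 'v \<Rightarrow> 'e list \<Rightarrow> 'm \<Rightarrow> real) \<Rightarrow> ('v \<Rightarrow> 'v \<Rightarrow> 'e list \<Rightarrow> 'm \<Rightarrow> real) \<Rightarrow> real" where
  "variation x w =
    (\<integral>\<theta>. (\<Sum>e\<in>arcs G. \<tau> e (\<theta> e) (flow x \<theta> e) * (flow w \<theta> e - flow x \<theta> e)) \<partial>law)"

text \<open>Left unnormalised: for a message of positive probability this is the conditional
  expectation times that probability, a factor common to all paths; messages of probability zero
  need no separate treatment.\<close>

definition expected_cost ::
  "('v \<Rightarrow> 'v \<Rightarrow> 'e list \<Rightarrow> 'm \<Rightarrow> real) \<Rightarrow> 'v \<Rightarrow> 'v \<Rightarrow> 'm \<Rightarrow> 'e list \<Rightarrow> real" where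
  "expected_cost x u v m p = (\<integral>\<theta>. path_cost G \<tau> p \<theta> (flow x \<theta>) * \<pi> \<theta> u v m \<partial>law)"

lemma integrable_path_cost:
  assumes "x \<in> choices G Ms" "u \<in> verts G" "v \<in> verts G" "m \<in> Ms" "od_paths G u v \<noteq> {}"
  shows "integrable law (\<lambda>\<theta>. path_cost G \<tau> p \<theta> (flow x \<theta>) * \<pi> \<theta> u v m)"
proof -
  have "integrable law (\<lambda>\<theta>. \<Sum>e\<in>arcs G. incidence e p * (\<tau> e (\<theta> e) (flow x \<theta> e) * \<pi> \<theta> u v m))"
    using assms
    by (intro Bochner_Integration.integrable_sum integrable_mult_right integrable_delay_flow[where B = 1])
      (auto simp: rule_measurable rule_nonneg rule_le_1)
  then show ?thesis
    by (simp add: path_cost_def sum_distrib_right mult.assoc)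
qed

lemma expected_cost_diff:
  assumes "x \<in> choices G Ms" "u \<in> verts G" "v \<in> verts G" "m \<in> Ms" "od_paths G u v \<noteq> {}"
  shows "(\<integral>\<theta>. (path_cost G \<tau> i \<theta> (flow x \<theta>) - path_cost G \<tau> j \<theta> (flow x \<theta>)) * \<pi> \<theta> u v m \<partial>law) =
    expected_cost x u v m i - expected_cost x u v m j"
  by (simp add: expected_cost_def left_diff_distrib integrable_path_cost[OF assms])

text \<open>Regrouping the links by paths, with the delays as weights, turns the integrand into path
  costs; the integral then passes through the finite sums. The contributions of different pairs and
  messages are thereby separated.\<close>

lemma variation_eq:
  assumes x: "x \<in> choices G Ms"
  shows "variation x w = (\<Sum>u\<in>verts G. \<Sum>v\<in>verts G. \<Sum>m\<in>Ms. \<Sum>p\<in>od_paths G u v.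
    \<upsilon> u v * (w u v p m - x u v p m) * expected_cost x u v m p)"
proof -
  have "(\<Sum>e\<in>arcs G. \<tau> e (\<theta> e) (flow x \<theta> e) * (flow w \<theta> e - flow x \<theta> e)) =
    (\<Sum>u\<in>verts G. \<Sum>v\<in>verts G. \<Sum>m\<in>Ms. \<Sum>p\<in>od_paths G u v.
      \<upsilon> u v * (w u v p m - x u v p m) * (path_cost G \<tau> p \<theta> (flow x \<theta>) * \<pi> \<theta> u v m))" for \<theta>
    unfolding right_diff_distrib sum_subtractf sum_mult_link_flow
    unfolding sum_subtractf[symmetric] path_cost_def[symmetric]
    by (intro sum.cong refl) (simp add: algebra_simps)
  then have "variation x w = (\<integral>\<theta>. (\<Sum>u\<in>verts G. \<Sum>v\<in>verts G. \<Sum>m\<in>Ms. \<Sum>p\<in>od_paths G u v.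
      \<upsilon> u v * (w u v p m - x u v p m) * (path_cost G \<tau> p \<theta> (flow x \<theta>) * \<pi> \<theta> u v m)) \<partial>law)"
    by (simp add: variation_def)
  also have "\<dots> = (\<Sum>u\<in>verts G. \<Sum>v\<in>verts G. \<Sum>m\<in>Ms. \<Sum>p\<in>od_paths G u v.
    (\<integral>\<theta>. \<upsilon> u v * (w u v p m - x u v p m) * (path_cost G \<tau> p \<theta> (flow x \<theta>) * \<pi> \<theta> u v m) \<partial>law))"
  proof -
    have int: "integrable law (\<lambda>\<theta>. \<upsilon> u v * (w u v p m - x u v p m) * (path_cost G \<tau> p \<theta> (flow x \<theta>) * \<pi> \<theta> u v m))"
      if "u \<in> verts G" "v \<in> verts G" "m \<in> Ms" "p \<in> od_paths G u v" for u v m p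
      using that x by (intro integrable_mult_right integrable_path_cost) auto
    \<comment> \<open>Each round moves the integral inside one more of the nested sums.\<close>
    show ?thesis
      by (subst Bochner_Integration.integral_sum,
          (intro Bochner_Integration.integrable_sum int; assumption), intro sum.cong refl)+
  qed
  finally show ?thesis
    by (simp add: expected_cost_def)
qed

lemma integrable_variation:
  assumes "y \<in> choices G Ms" "x \<in> choices G Ms" "w \<in> choices G Ms" "e \<in> arcs G"
  shows "integrable law (\<lambda>\<theta>. \<tau> e (\<theta> e) (flow y \<theta> e) * (flow w \<theta> e - flow x \<theta> e))"
proof (rule integrable_delay_flow[OF assms(4,1), where B = demand])
  fix \<theta> assume th: "\<theta> \<in> space (state_space G)"
  show "\<bar>flow w \<theta> e - flow x \<theta> e\<bar> \<le> demand"
    using flow_bounds[OF assms(2) th, of e] flow_bounds[OF assms(3) th, of e] by linarith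
qed (intro borel_measurable_diff flow_measurable)

section \<open>Minimisers of the potential satisfy the variational inequality\<close>

text \<open>The subgradient inequality, summed and integrated. Its slope is taken at the new point
  \<open>x\<close>, so that it bounds the increase of the potential from above.\<close>

lemma potential_diff_le:
  assumes y: "y \<in> choices G Ms" and x: "x \<in> choices G Ms"
  shows "\<Phi> x - \<Phi> y \<le>
    (\<integral>\<theta>. (\<Sum>e\<in>arcs G. \<tau> e (\<theta> e) (flow x \<theta> e) * (flow x \<theta> e - flow y \<theta> e)) \<partial>law)"
proof -
  have int: "integrable law (\<lambda>\<theta>. \<Sum>e\<in>arcs G. delay_integral e (\<theta> e) (flow z \<theta> e))"
    if "z \<in> choices G Ms" for z
    using that by (intro Bochner_Integration.integrable_sum integrable_delay_integral)
      (auto simp: flow_measurable flow_bounds)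
  have "\<Phi> x - \<Phi> y = (\<integral>\<theta>. (\<Sum>e\<in>arcs G. delay_integral e (\<theta> e) (flow x \<theta> e)) -
      (\<Sum>e\<in>arcs G. delay_integral e (\<theta> e) (flow y \<theta> e)) \<partial>law)"
    unfolding potential_def by (simp add: int x y)
  also have "\<dots> \<le> (\<integral>\<theta>. (\<Sum>e\<in>arcs G. \<tau> e (\<theta> e) (flow x \<theta> e) * (flow x \<theta> e - flow y \<theta> e)) \<partial>law)"
  proof (rule integral_mono)
    fix \<theta> assume "\<theta> \<in> space law"
    then have th: "\<theta> \<in> space (state_space G)"
      by simp
    show "(\<Sum>e\<in>arcs G. delay_integral e (\<theta> e) (flow x \<theta> e)) -
        (\<Sum>e\<in>arcs G. delay_integral e (\<theta> e) (flow y \<theta> e)) \<le>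
        (\<Sum>e\<in>arcs G. \<tau> e (\<theta> e) (flow x \<theta> e) * (flow x \<theta> e - flow y \<theta> e))"
      unfolding sum_subtractf[symmetric]
      by (intro sum_mono delay_integral_diff_le state_nonneg[OF th] flow_bounds[OF _ th] x y)
  qed (intro Bochner_Integration.integrable_diff Bochner_Integration.integrable_sum
      int x y integrable_variation; assumption)+
  finally show ?thesis .
qed

text \<open>Minimality makes the increase of the potential nonnegative along the segment from
  \<open>y\<close> to \<open>w\<close>, hence also the larger slope at the displaced point.
  Dominated convergence carries the sign of these slopes to the limit, so the potential need not be
  differentiated under the integral.\<close>

lemma minimiser_variation_nonneg:
  assumes "solves_P G \<upsilon> \<tau> law Ms \<pi> y" and w: "w \<in> choices G Ms"
  shows "0 \<le> variation y w"
proof -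
  from assms(1) have y: "y \<in> choices G Ms" and min: "\<And>x. x \<in> choices G Ms \<Longrightarrow> \<Phi> y \<le> \<Phi> x"
    by (auto simp: solves_P_def is_arg_min_def not_less)
  \<comment> \<open>Step sizes in \<open>(0, 1]\<close> tending to 0 keep each displaced point
    \<open>c n\<close> a convex combination of \<open>y\<close> and \<open>w\<close>.\<close>
  define t :: "nat \<Rightarrow> real" where "t n = inverse (real (Suc n))" for n
  have t: "0 < t n" "t n \<le> 1" for n
    by (auto simp: t_def field_simps)
  define c where "c n = (\<lambda>u v p m. y u v p m + t n * (w u v p m - y u v p m))" for n
  have c: "c n \<in> choices G Ms" for n
    unfolding c_def using t[of n] by (intro choices_convex w y) auto
  have flow_c: "flow (c n) \<theta> e = flow y \<theta> e + t n * (flow w \<theta> e - flow y \<theta> e)" for n \<theta> e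
    unfolding c_def by (rule link_flow_convex)
  \<comment> \<open>The slope at \<open>c n\<close> in the full direction from \<open>y\<close> to
    \<open>w\<close>; the positive factor \<open>t n\<close> is split off and cancelled
    below.\<close>
  define s where
    "s n \<theta> = (\<Sum>e\<in>arcs G. \<tau> e (\<theta> e) (flow (c n) \<theta> e) * (flow w \<theta> e - flow y \<theta> e))" for n \<theta>
  have s_int: "integrable law (s n)" for n
    unfolding s_def by (intro Bochner_Integration.integrable_sum integrable_variation c w y)
  have nonneg: "0 \<le> integral\<^sup>L law (s n)" for n
  proof -
    have "0 \<le> \<Phi> (c n) - \<Phi> y"
      using min[OF c] by simp
    also have "\<dots> \<le>
        (\<integral>\<theta>. (\<Sum>e\<in>arcs G. \<tau> e (\<theta> e) (flow (c n) \<theta> e) * (flow (c n) \<theta> e - flow y \<theta> e)) \<partial>law)"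
      by (rule potential_diff_le[OF y c])
    also have "\<dots> = (\<integral>\<theta>. t n * s n \<theta> \<partial>law)"
      unfolding s_def sum_distrib_left by (simp add: flow_c mult_ac)
    also have "\<dots> = t n * integral\<^sup>L law (s n)"
      by simp
    finally show ?thesis
      using t(1)[of n] by (simp add: zero_le_mult_iff)
  qed
  have "(\<lambda>n. integral\<^sup>L law (s n)) \<longlonglongrightarrow> variation y w"
    unfolding variation_def
  proof (rule integral_dominated_convergence)
    \<comment> \<open>All flows lie between 0 and \<open>demand\<close>, which bounds both the
      delays and the flow differences.\<close>
    show "integrable law (\<lambda>\<theta>. \<Sum>e\<in>arcs G. \<tau> e (\<theta> e) demand * demand)"
      by (intro Bochner_Integration.integrable_sum integrable_mult_left integrable_delay_demand)
    show "AE \<theta> in law. (\<lambda>n. s n \<theta>) \<longlonglongrightarrow>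
        (\<Sum>e\<in>arcs G. \<tau> e (\<theta> e) (flow y \<theta> e) * (flow w \<theta> e - flow y \<theta> e))"
    proof (rule AE_I2)
      fix \<theta> assume "\<theta> \<in> space law"
      then have th: "\<theta> \<in> space (state_space G)"
        by simp
      have "(\<lambda>n. flow (c n) \<theta> e) \<longlonglongrightarrow> flow y \<theta> e + 0 * (flow w \<theta> e - flow y \<theta> e)" for e
        unfolding flow_c t_def by (intro tendsto_intros LIMSEQ_inverse_real_of_nat)
      then have lim: "(\<lambda>n. flow (c n) \<theta> e) \<longlonglongrightarrow> flow y \<theta> e" for e
        by simp
      show "(\<lambda>n. s n \<theta>) \<longlonglongrightarrow>
          (\<Sum>e\<in>arcs G. \<tau> e (\<theta> e) (flow y \<theta> e) * (flow w \<theta> e - flow y \<theta> e))"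
        unfolding s_def
        by (intro tendsto_sum tendsto_mult tendsto_const
            continuous_on_tendsto_compose[OF delay_continuous[OF _ state_nonneg[OF th]]] lim)
          (auto simp: flow_bounds[OF _ th] y c)
    qed
    fix n
    show "AE \<theta> in law. norm (s n \<theta>) \<le> (\<Sum>e\<in>arcs G. \<tau> e (\<theta> e) demand * demand)"
    proof (rule AE_I2)
      fix \<theta> assume "\<theta> \<in> space law"
      then have th: "\<theta> \<in> space (state_space G)"
        by simp
      show "norm (s n \<theta>) \<le> (\<Sum>e\<in>arcs G. \<tau> e (\<theta> e) demand * demand)"
        unfolding s_def
      proof (rule sum_norm_le)
        fix e assume e: "e \<in> arcs G"
        note nn = state_nonneg[OF th e]
        have "\<bar>\<tau> e (\<theta> e) (flow (c n) \<theta> e)\<bar> \<le> \<tau> e (\<theta> e) demand"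
          using delay_mono[OF e nn] delay_nonneg[OF e nn] flow_bounds[OF c th] by simp
        moreover have "\<bar>flow w \<theta> e - flow y \<theta> e\<bar> \<le> demand"
          using flow_bounds[OF w th, of e] flow_bounds[OF y th, of e] by linarith
        ultimately show "norm (\<tau> e (\<theta> e) (flow (c n) \<theta> e) * (flow w \<theta> e - flow y \<theta> e))
            \<le> \<tau> e (\<theta> e) demand * demand"
          by (simp add: abs_mult mult_mono)
      qed
    qed
  qed (use s_int integrable_variation[OF y y w] in \<open>auto intro!: borel_measurable_sum dest!: borel_measurable_integrable\<close>)
  then show ?thesis
    by (rule LIMSEQ_le_const) (auto intro: nonneg)
qed

section \<open>Equilibria as solutions of the variational inequality\<close>

text \<open>Test the inequality with the choice that moves all mass on \<open>i\<close> to
  \<open>j\<close>, for this pair and message only. The variation becomes the moved mass of users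
  times the cost difference.\<close>

lemma variation_nonneg_imp_best_response:
  assumes x: "x \<in> choices G Ms" and vi: "\<And>w. w \<in> choices G Ms \<Longrightarrow> 0 \<le> variation x w"
    and uvm: "u \<in> verts G" "v \<in> verts G" "m \<in> Ms"
    and ij: "i \<in> od_paths G u v" "j \<in> od_paths G u v"
    and pos: "0 < \<upsilon> u v" "0 < x u v i m"
  shows "expected_cost x u v m i \<le> expected_cost x u v m j"
proof -
  \<comment> \<open>A difference of two conditionals, so that the terms cancel when
    \<open>i = j\<close>.\<close>
  define d :: "'e list \<Rightarrow> real" where
    "d p = (if p = j then x u v i m else 0) - (if p = i then x u v i m else 0)" for p
  define w where "w u' v' p m' = x u' v' p m' + (if u' = u \<and> v' = v \<and> m' = m then d p else 0)"
    for u' v' p m'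
  have paths: "i \<in> paths G" "j \<in> paths G"
    using od_paths_subset[OF uvm(1,2)] ij by auto
  have "w \<in> choices G Ms"
    unfolding choices_def
  proof (intro CollectI ballI conjI impI)
    fix u' v' m' p assume *: "u' \<in> verts G" "v' \<in> verts G" "m' \<in> Ms"
    { assume "p \<in> paths G"
      then show "0 \<le> w u' v' p m'"
        using x * pos(2) by (auto simp: w_def d_def choices_def) }
    { assume "p \<in> paths G - od_paths G u' v'"
      then show "w u' v' p m' = 0"
        using x * ij by (auto simp: w_def d_def choices_def) }
    { assume ne: "od_paths G u' v' \<noteq> {}"
      have "(\<Sum>p\<in>paths G. d p) = 0"
        using paths by (simp add: d_def sum_subtractf)
      moreover have "(\<Sum>p\<in>paths G. x u' v' p m') = 1"
        using x * ne by (simp add: choices_def)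
      ultimately show "(\<Sum>p\<in>paths G. w u' v' p m') = 1"
        by (cases "u' = u \<and> v' = v \<and> m' = m"; auto simp: w_def sum.distrib intro!: sum.neutral) }
  qed
  then have "0 \<le> variation x w"
    by (rule vi)
  \<comment> \<open>The change is confined to one pair and one message; nesting the conditions lets
    the three outer sums collapse by \<open>sum_if_const\<close>.\<close>
  also have "variation x w = (\<Sum>u'\<in>verts G. \<Sum>v'\<in>verts G. \<Sum>m'\<in>Ms.
      if u' = u then if v' = v then if m' = m
        then \<Sum>p\<in>od_paths G u v. \<upsilon> u v * d p * expected_cost x u v m p else 0 else 0 else 0)"
    unfolding variation_eq[OF x] by (intro sum.cong refl) (simp add: w_def)
  also have "\<dots> = (\<Sum>p\<in>od_paths G u v. \<upsilon> u v * d p * expected_cost x u v m p)"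
    using uvm by (simp add: sum_if_const)
  also have "\<dots> = \<upsilon> u v * x u v i m * (expected_cost x u v m j - expected_cost x u v m i)"
  proof -
    have "\<upsilon> u v * d p * expected_cost x u v m p =
        (if p = j then \<upsilon> u v * x u v i m * expected_cost x u v m j else 0) -
        (if p = i then \<upsilon> u v * x u v i m * expected_cost x u v m i else 0)" for p
      by (simp add: d_def)
    then show ?thesis
      using ij by (simp add: sum_subtractf right_diff_distrib)
  qed
  finally show ?thesis
    using mult_pos_pos[OF pos] by (simp add: zero_le_mult_iff)
qed

lemma variation_nonneg_imp_bwe:
  assumes x: "x \<in> choices G Ms" and vi: "\<And>w. w \<in> choices G Ms \<Longrightarrow> 0 \<le> variation x w"
  shows "is_bwe G \<upsilon> \<tau> law Ms \<pi> (flow x)"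
proof -
  define best where "best u v m = arg_min_on (expected_cost x u v m) (od_paths G u v)" for u v m
  have best: "best u v m \<in> od_paths G u v"
      "\<And>j. j \<in> od_paths G u v \<Longrightarrow> expected_cost x u v m (best u v m) \<le> expected_cost x u v m j"
    if "od_paths G u v \<noteq> {}" for u v m
    unfolding best_def using that by (auto intro: arg_min_if_finite arg_min_least)
  text \<open>The equilibrium inequalities also concern pairs without users, on which the potential
    does not depend; there the choice is redirected to a cheapest path.\<close>
  define z where "z u v p m = (if 0 < \<upsilon> u v then x u v p m
      else if od_paths G u v \<noteq> {} \<and> p = best u v m then 1 else 0)" for u v p m
  have z: "z \<in> choices G Ms"
    unfolding choices_def
  proof (intro CollectI ballI conjI impI)
    fix u v m p assume *: "u \<in> verts G" "v \<in> verts G" "m \<in> Ms"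
    { assume "p \<in> paths G"
      then show "0 \<le> z u v p m"
        using x * by (auto simp: z_def choices_def) }
    { assume "p \<in> paths G - od_paths G u v"
      then show "z u v p m = 0"
        using x * best(1)[of u v m] by (auto simp: z_def choices_def) }
    { assume ne: "od_paths G u v \<noteq> {}"
      then show "(\<Sum>p\<in>paths G. z u v p m) = 1"
        using x * best(1)[OF ne, of m] od_paths_subset[OF *(1,2)]
        by (cases "0 < \<upsilon> u v") (simp_all add: z_def choices_def subset_eq) }
  qed
  \<comment> \<open>Where \<open>z\<close> departs from \<open>x\<close> the throughput is not
    positive, hence zero.\<close>
  have flow_z: "flow z = flow x"
    by (intro ext link_flow_cong) (auto simp: z_def dest: throughput_nonneg)
  have "(\<integral>\<theta>. (path_cost G \<tau> i \<theta> (flow x \<theta>) - path_cost G \<tau> j \<theta> (flow x \<theta>)) * \<pi> \<theta> u v m \<partial>law) \<le> 0"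
    if *: "u \<in> verts G" "v \<in> verts G" "m \<in> Ms" "i \<in> od_paths G u v" "j \<in> od_paths G u v"
      and pos: "0 < z u v i m" for u v m i j
  proof -
    have ne: "od_paths G u v \<noteq> {}"
      using * by auto
    have "expected_cost x u v m i \<le> expected_cost x u v m j"
    proof (cases "0 < \<upsilon> u v")
      case True
      then show ?thesis
        using * pos by (intro variation_nonneg_imp_best_response[OF x vi]) (auto simp: z_def)
    next
      case False
      then have "i = best u v m"
        using pos by (simp add: z_def split: if_splits)
      then show ?thesis
        using best(2)[OF ne *(5)] by simp
    qed
    then show ?thesis
      using * ne by (simp add: expected_cost_diff[OF x])
  qed
  with z flow_z show ?thesis
    unfolding is_bwe_def by (intro bexI[of _ z]) auto
qed

text \<open>An equilibrium choice charges only paths of least expected cost, so its average cost is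
  at most that of any other choice \<open>w\<close>; \<open>variation_eq\<close> adds up these
  comparisons.\<close>

lemma bwe_imp_variation_nonneg:
  assumes "is_bwe G \<upsilon> \<tau> law Ms \<pi> f"
  obtains x where "x \<in> choices G Ms"
    "\<And>\<theta> e. \<theta> \<in> space (state_space G) \<Longrightarrow> e \<in> arcs G \<Longrightarrow> f \<theta> e = flow x \<theta> e"
    "\<And>w. w \<in> choices G Ms \<Longrightarrow> 0 \<le> variation x w"
proof -
  from assms obtain x where x: "x \<in> choices G Ms"
    and fx_all: "\<forall>\<theta>\<in>space (state_space G). \<forall>e\<in>arcs G. f \<theta> e = flow x \<theta> e"
    and eq: "\<forall>u\<in>verts G. \<forall>v\<in>verts G. \<forall>i\<in>od_paths G u v. \<forall>m\<in>Ms. 0 < x u v i m \<longrightarrow>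
      (\<forall>j\<in>od_paths G u v.
        (\<integral>\<theta>. (path_cost G \<tau> i \<theta> (f \<theta>) - path_cost G \<tau> j \<theta> (f \<theta>)) * \<pi> \<theta> u v m \<partial>law) \<le> 0)"
    unfolding is_bwe_def by (elim bexE conjE)
  have fx: "f \<theta> e = flow x \<theta> e" if "\<theta> \<in> space (state_space G)" "e \<in> arcs G" for \<theta> e
    using fx_all that by blast
  have cost: "path_cost G \<tau> p \<theta> (f \<theta>) = path_cost G \<tau> p \<theta> (flow x \<theta>)"
    if "\<theta> \<in> space (state_space G)" for p \<theta>
    unfolding path_cost_def using fx that by simp
  have le: "expected_cost x u v m i \<le> expected_cost x u v m j"
    if *: "u \<in> verts G" "v \<in> verts G" "m \<in> Ms" "i \<in> od_paths G u v" "j \<in> od_paths G u v"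
      "0 < x u v i m" for u v m i j
  proof -
    have "expected_cost x u v m i - expected_cost x u v m j =
        (\<integral>\<theta>. (path_cost G \<tau> i \<theta> (flow x \<theta>) - path_cost G \<tau> j \<theta> (flow x \<theta>)) * \<pi> \<theta> u v m \<partial>law)"
      using * by (intro expected_cost_diff[OF x, symmetric]) auto
    also have "\<dots> = (\<integral>\<theta>. (path_cost G \<tau> i \<theta> (f \<theta>) - path_cost G \<tau> j \<theta> (f \<theta>)) * \<pi> \<theta> u v m \<partial>law)"
      by (intro Bochner_Integration.integral_cong refl) (simp add: cost)
    also have "\<dots> \<le> 0"
      by (rule eq[rule_format]) (use * in auto)
    finally show ?thesis
      by simp
  qed
  have vi: "0 \<le> variation x w" if w: "w \<in> choices G Ms" for w
    unfolding variation_eq[OF x]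
  proof (rule sum_nonneg, rule sum_nonneg, rule sum_nonneg)
    fix u v m assume *: "u \<in> verts G" "v \<in> verts G" "m \<in> Ms"
    let ?K = "expected_cost x u v m"
    let ?R = "od_paths G u v"
    show "0 \<le> (\<Sum>p\<in>?R. \<upsilon> u v * (w u v p m - x u v p m) * ?K p)"
    proof (cases "?R = {}")
      case False
      \<comment> \<open>Inserting the total mass 1 of \<open>w\<close> turns the average cost into a
        double sum over \<open>p\<close> and \<open>q\<close>, which is compared termwise;
        afterwards the mass of \<open>x\<close> is summed out.\<close>
      have "(\<Sum>p\<in>?R. x u v p m * ?K p) = (\<Sum>p\<in>?R. \<Sum>q\<in>?R. w u v q m * (x u v p m * ?K p))"
        using False choices_sum[OF w] * by (simp add: sum_distrib_right[symmetric])
      also have "\<dots> \<le> (\<Sum>p\<in>?R. \<Sum>q\<in>?R. w u v q m * (x u v p m * ?K q))"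
      proof (intro sum_mono)
        fix p q assume "p \<in> ?R" "q \<in> ?R"
        moreover from this have "x u v p m * ?K p \<le> x u v p m * ?K q"
          using le[OF *, of p q] choices_nonneg[OF x *, of p]
          by (cases "x u v p m = 0") (auto intro: mult_left_mono)
        ultimately show "w u v q m * (x u v p m * ?K p) \<le> w u v q m * (x u v p m * ?K q)"
          using choices_nonneg[OF w *] by (intro mult_left_mono[of "x u v p m * ?K p"])
      qed
      also have "\<dots> = (\<Sum>q\<in>?R. w u v q m * ?K q)"
        using False choices_sum[OF x] *
        by (subst sum.swap) (simp add: sum_distrib_left[symmetric] sum_distrib_right[symmetric])
      finally have "0 \<le> \<upsilon> u v * (\<Sum>p\<in>?R. (w u v p m - x u v p m) * ?K p)"
        using throughput_nonneg * by (simp add: left_diff_distrib sum_subtractf)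
      then show ?thesis
        by (simp add: sum_distrib_left mult.assoc)
    qed simp
  qed
  show ?thesis
    using that x fx vi by blast
qed

section \<open>Almost sure uniqueness of the equilibrium flow\<close>

text \<open>The two variations add up to minus the integral of delay differences times flow
  differences. Strictly increasing delays make this integrand nonnegative, and positive where the
  flows differ; its integral is at most 0, so it vanishes almost surely.\<close>

lemma variation_nonneg_imp_flow_eq:
  assumes x: "x \<in> choices G Ms" and w: "w \<in> choices G Ms"
    and "0 \<le> variation x w" "0 \<le> variation w x"
  shows "AE \<theta> in law. \<forall>e\<in>arcs G. flow x \<theta> e = flow w \<theta> e"
proof -
  define g where "g \<theta> e = (\<tau> e (\<theta> e) (flow x \<theta> e) - \<tau> e (\<theta> e) (flow w \<theta> e)) *
    (flow x \<theta> e - flow w \<theta> e)" for \<theta> e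
  define h where "h x w \<theta> = (\<Sum>e\<in>arcs G. \<tau> e (\<theta> e) (flow x \<theta> e) * (flow w \<theta> e - flow x \<theta> e))"
    for x w \<theta>
  have hint: "integrable law (h x w)" if "x \<in> choices G Ms" "w \<in> choices G Ms" for x w
    unfolding h_def using that
    by (intro Bochner_Integration.integrable_sum integrable_variation)
  have gh: "(\<Sum>e\<in>arcs G. g \<theta> e) = - (h x w \<theta> + h w x \<theta>)" for \<theta>
    unfolding h_def g_def sum.distrib[symmetric] sum_negf[symmetric]
    by (intro sum.cong refl) (simp add: algebra_simps)
  have pos: "0 < g \<theta> e"
    if "\<theta> \<in> space (state_space G)" "e \<in> arcs G" "flow x \<theta> e \<noteq> flow w \<theta> e" for \<theta> e
  proof -
    note mono = strict_mono_onD[OF delay_strict_mono[OF that(2) state_nonneg[OF that(1,2)]]]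
    show ?thesis
      using that(3) mono[of "flow x \<theta> e" "flow w \<theta> e"] mono[of "flow w \<theta> e" "flow x \<theta> e"]
        flow_bounds(1)[OF x that(1)] flow_bounds(1)[OF w that(1)]
      by (cases "flow x \<theta> e" "flow w \<theta> e" rule: linorder_cases)
        (auto simp: g_def intro: mult_pos_pos mult_neg_neg)
  qed
  have g_nonneg: "0 \<le> g \<theta> e" if "\<theta> \<in> space (state_space G)" "e \<in> arcs G" for \<theta> e
    using pos[OF that] by (cases "flow x \<theta> e = flow w \<theta> e") (auto simp: g_def)
  have int: "integrable law (\<lambda>\<theta>. \<Sum>e\<in>arcs G. g \<theta> e)"
    unfolding gh using hint x w by simp
  have "(\<integral>\<theta>. (\<Sum>e\<in>arcs G. g \<theta> e) \<partial>law) = - (variation x w + variation w x)"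
    unfolding gh variation_def h_def[symmetric] using hint x w by simp
  then have "(\<integral>\<theta>. (\<Sum>e\<in>arcs G. g \<theta> e) \<partial>law) \<le> 0"
    using assms(3,4) by simp
  moreover have "0 \<le> (\<integral>\<theta>. (\<Sum>e\<in>arcs G. g \<theta> e) \<partial>law)"
    by (intro Bochner_Integration.integral_nonneg_AE AE_I2 sum_nonneg) (simp add: g_nonneg)
  ultimately have "AE \<theta> in law. (\<Sum>e\<in>arcs G. g \<theta> e) = 0"
    by (subst integral_nonneg_eq_0_iff_AE[OF int, symmetric])
      (auto intro!: AE_I2 sum_nonneg simp: g_nonneg)
  then show ?thesis
  proof (rule AE_mp, intro AE_I2 impI ballI)
    fix \<theta> e assume th: "\<theta> \<in> space law" and 0: "(\<Sum>e\<in>arcs G. g \<theta> e) = 0" and e: "e \<in> arcs G"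
    then have "g \<theta> e = 0"
      using sum_nonneg_eq_0_iff[of "arcs G" "g \<theta>"] by (simp add: g_nonneg)
    then show "flow x \<theta> e = flow w \<theta> e"
      using pos[of \<theta> e] th e by force
  qed
qed

corollary bwe_unique:
  assumes "is_bwe G \<upsilon> \<tau> law Ms \<pi> f" "is_bwe G \<upsilon> \<tau> law Ms \<pi> g"
  shows "AE \<theta> in law. \<forall>e\<in>arcs G. f \<theta> e = g \<theta> e"
proof -
  obtain x where x: "x \<in> choices G Ms"
    "\<And>\<theta> e. \<theta> \<in> space (state_space G) \<Longrightarrow> e \<in> arcs G \<Longrightarrow> f \<theta> e = flow x \<theta> e"
    "\<And>w. w \<in> choices G Ms \<Longrightarrow> 0 \<le> variation x w"
    using bwe_imp_variation_nonneg[OF assms(1)] by blast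
  obtain w where w: "w \<in> choices G Ms"
    "\<And>\<theta> e. \<theta> \<in> space (state_space G) \<Longrightarrow> e \<in> arcs G \<Longrightarrow> g \<theta> e = flow w \<theta> e"
    "\<And>x. x \<in> choices G Ms \<Longrightarrow> 0 \<le> variation w x"
    using bwe_imp_variation_nonneg[OF assms(2)] by blast
  have "AE \<theta> in law. \<forall>e\<in>arcs G. flow x \<theta> e = flow w \<theta> e"
    using x w by (intro variation_nonneg_imp_flow_eq) auto
  then show ?thesis
    by (rule AE_mp, intro AE_I2) (simp add: x w)
qed

text \<open>An equilibrium \<open>f\<close> is an arbitrary function that agrees with a flow on the
  states and links, which yields the measurability that \<open>integral_cong_AE\<close> requires for
  comparing system costs.\<close>

lemma bwe_delay_cost_measurable:
  assumes "is_bwe G \<upsilon> \<tau> law Ms \<pi> f"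
  shows "(\<lambda>\<omega>. \<Sum>e\<in>arcs G. f (\<Theta> \<omega>) e * \<tau> e (\<Theta> \<omega> e) (f (\<Theta> \<omega>) e)) \<in> borel_measurable \<Omega>"
proof -
  obtain x where x: "x \<in> choices G Ms"
    and fx: "\<And>\<theta> e. \<theta> \<in> space (state_space G) \<Longrightarrow> e \<in> arcs G \<Longrightarrow> f \<theta> e = flow x \<theta> e"
    and "\<And>w. w \<in> choices G Ms \<Longrightarrow> 0 \<le> variation x w"
    using bwe_imp_variation_nonneg[OF assms] by blast
  have "(\<lambda>\<theta>. \<Sum>e\<in>arcs G. flow x \<theta> e * \<tau> e (\<theta> e) (flow x \<theta> e)) \<in> borel_measurable (state_space G)"
    by (intro borel_measurable_sum borel_measurable_times flow_measurable
        delay_compose_measurable state_component_measurable)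
      (auto simp: state_nonneg flow_bounds x)
  then have "(\<lambda>\<theta>. \<Sum>e\<in>arcs G. f \<theta> e * \<tau> e (\<theta> e) (f \<theta> e)) \<in> borel_measurable (state_space G)"
    by (rule measurable_cong[THEN iffD1, rotated]) (simp add: fx)
  from measurable_compose[OF state_measurable this] show ?thesis .
qed

text \<open>Serves to replace a flow of the direct rule by the original flow, as the two are known
  to agree only on the state space.\<close>

lemma is_bwe_cong:
  assumes "is_bwe G \<upsilon> \<tau> law Ms \<pi> f"
    and "\<And>\<theta> e. \<theta> \<in> space (state_space G) \<Longrightarrow> e \<in> arcs G \<Longrightarrow> g \<theta> e = f \<theta> e"
  shows "is_bwe G \<upsilon> \<tau> law Ms \<pi> g"
proof -
  have "(\<integral>\<theta>. (path_cost G \<tau> i \<theta> (g \<theta>) - path_cost G \<tau> j \<theta> (g \<theta>)) * \<pi> \<theta> u v m \<partial>law) =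
      (\<integral>\<theta>. (path_cost G \<tau> i \<theta> (f \<theta>) - path_cost G \<tau> j \<theta> (f \<theta>)) * \<pi> \<theta> u v m \<partial>law)" for i j u v m
    by (intro Bochner_Integration.integral_cong refl) (simp add: path_cost_def assms(2))
  with assms show ?thesis
    by (simp add: is_bwe_def)
qed

section \<open>Directness of the induced rule\<close>

text \<open>As a composition of \<open>\<pi>\<close> with \<open>y\<close>, the rule inherits
  normalisation from both, and its support from \<open>y\<close>, which never uses a path of another
  pair.\<close>

lemma direct_revelation:
  assumes y: "y \<in> choices G Ms"
    and \<pi>': "\<And>\<theta> u v p. \<theta> \<in> space (state_space G) \<Longrightarrow> u \<in> verts G \<Longrightarrow> v \<in> verts G \<Longrightarrow>
      p \<in> paths G \<Longrightarrow> \<pi>' \<theta> u v p = (\<Sum>m\<in>Ms. y u v p m * \<pi> \<theta> u v m)"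
  shows "direct G \<pi>'"
  unfolding direct_def rules_def
proof (intro conjI CollectI ballI impI)
  fix u v assume uv: "u \<in> verts G" "v \<in> verts G"
  { fix p assume p: "p \<in> paths G"
    have "(\<lambda>\<theta>. \<Sum>m\<in>Ms. y u v p m * \<pi> \<theta> u v m) \<in> borel_measurable (state_space G)"
      using uv by (intro borel_measurable_sum borel_measurable_times borel_measurable_const rule_measurable)
    then show "(\<lambda>\<theta>. \<pi>' \<theta> u v p) \<in> borel_measurable (state_space G)"
      by (rule measurable_cong[THEN iffD1, rotated]) (simp add: \<pi>' uv p) }
  fix \<theta> assume th: "\<theta> \<in> space (state_space G)"
  { fix p assume "p \<in> paths G"
    then show "0 \<le> \<pi>' \<theta> u v p"
      using uv th y by (auto simp: \<pi>' choices_def rule_nonneg intro!: sum_nonneg mult_nonneg_nonneg) }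
  { fix p assume "p \<in> paths G - od_paths G u v"
    then show "\<pi>' \<theta> u v p = 0"
      using uv th y by (auto simp: \<pi>' choices_def intro!: sum.neutral) }
  { assume ne: "od_paths G u v \<noteq> {}"
    have "(\<Sum>p\<in>paths G. \<pi>' \<theta> u v p) = (\<Sum>m\<in>Ms. (\<Sum>p\<in>paths G. y u v p m) * \<pi> \<theta> u v m)"
      using uv th by (simp add: \<pi>' sum_distrib_right sum.swap[of _ Ms])
    also have "\<dots> = 1"
      using uv ne y rule_sum[OF th uv ne] by (simp add: choices_def)
    finally show "(\<Sum>p\<in>paths G. \<pi>' \<theta> u v p) = 1" . }
qed

end

theorem theorem1:
  fixes G :: "('v, 'e) pre_digraph"
    and \<upsilon> :: "'v \<Rightarrow> 'v \<Rightarrow> real"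
    and \<Omega> :: "'w measure"
    and \<Theta> :: "'w \<Rightarrow> 'e \<Rightarrow> real"
    and \<tau> :: "'e \<Rightarrow> real \<Rightarrow> real \<Rightarrow> real"
    and P :: "('e \<Rightarrow> real) measure"
    and Ms :: "'m set"
    and \<pi> :: "('e \<Rightarrow> real) \<Rightarrow> 'v \<Rightarrow> 'v \<Rightarrow> 'm \<Rightarrow> real"
    and y :: "'v \<Rightarrow> 'v \<Rightarrow> 'e list \<Rightarrow> 'm \<Rightarrow> real"
    and \<pi>' :: "('e \<Rightarrow> real) \<Rightarrow> 'v \<Rightarrow> 'v \<Rightarrow> 'e list \<Rightarrow> real"
  assumes "stochastic_network G \<Omega> \<upsilon> \<Theta> \<tau>"
    and "P = distr \<Omega> (state_space G) \<Theta>"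
    and "finite Ms"
    and "\<pi> \<in> rules G Ms"
    and "solves_P G \<upsilon> \<tau> P Ms \<pi> y"
    and "\<And>\<theta> u v p. \<theta> \<in> space (state_space G) \<Longrightarrow> u \<in> verts G \<Longrightarrow> v \<in> verts G \<Longrightarrow> p \<in> paths G \<Longrightarrow>
           \<pi>' \<theta> u v p = (\<Sum>m\<in>Ms. y u v p m * \<pi> \<theta> u v m)"
  shows "\<pi>' \<in> rules G (paths G) \<and> direct G \<pi>' \<and> obedient G \<upsilon> \<tau> P \<pi>' \<and>
    is_bwe G \<upsilon> \<tau> P Ms \<pi> (link_flow G \<upsilon> Ms \<pi> y) \<and>
    is_bwe G \<upsilon> \<tau> P (paths G) \<pi>' (link_flow G \<upsilon> Ms \<pi> y) \<and>
    (\<forall>f g. is_bwe G \<upsilon> \<tau> P Ms \<pi> f \<and> is_bwe G \<upsilon> \<tau> P (paths G) \<pi>' g \<longrightarrow>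
       (AE \<theta> in P. \<forall>e\<in>arcs G. f \<theta> e = g \<theta> e) \<and>
       system_cost G \<tau> \<Omega> \<Theta> f = system_cost G \<tau> \<Omega> \<Theta> g)"
proof -
  interpret stochastic_network G \<Omega> \<upsilon> \<Theta> \<tau>
    by (fact assms(1))
  interpret orig: signaling G \<Omega> \<upsilon> \<Theta> \<tau> Ms \<pi>
    by unfold_locales (fact assms)+
  note P = assms(2) and \<pi>' = assms(6)
  have y: "y \<in> choices G Ms"
    and min: "\<And>x. x \<in> choices G Ms \<Longrightarrow> orig.\<Phi> y \<le> orig.\<Phi> x"
    using assms(5) by (auto simp: P solves_P_def is_arg_min_def not_less)
  have direct: "direct G \<pi>'"
    using y \<pi>' by (rule orig.direct_revelation)
  then have rules: "\<pi>' \<in> rules G (paths G)"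
    by (simp add: direct_def)
  interpret dir: signaling G \<Omega> \<upsilon> \<Theta> \<tau> "paths G" \<pi>'
    by unfold_locales (simp_all add: rules)
  have flow: "dir.flow x \<theta> e = orig.flow (compose_choices G x y) \<theta> e"
    if "\<theta> \<in> space (state_space G)" for x \<theta> e
    using that by (intro link_flow_compose \<pi>')
  have pot: "dir.\<Phi> x = orig.\<Phi> (compose_choices G x y)" for x
    unfolding potential_def by (intro Bochner_Integration.integral_cong refl) (simp add: flow)
  have flow_id: "orig.flow (compose_choices G x y) = orig.flow y"
    if "\<forall>u\<in>verts G. \<forall>v\<in>verts G. \<forall>i\<in>od_paths G u v. \<forall>j\<in>od_paths G u v.
      x u v i j = (if i = j then 1 else 0)" for x
    using that by (intro ext link_flow_cong) (simp add: compose_identity[OF y])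
  have solves: "solves_P G \<upsilon> \<tau> law (paths G) \<pi>' x"
    if x: "x \<in> choices G (paths G)"
      and id: "\<forall>u\<in>verts G. \<forall>v\<in>verts G. \<forall>i\<in>od_paths G u v. \<forall>j\<in>od_paths G u v.
        x u v i j = (if i = j then 1 else 0)" for x
  proof -
    have "dir.\<Phi> x = orig.\<Phi> y"
      unfolding pot by (simp add: potential_def flow_id[OF id])
    \<comment> \<open>A competitor under the direct rule, composed with \<open>y\<close>, is a
      competitor of \<open>y\<close> under the original rule.\<close>
    moreover have "orig.\<Phi> y \<le> dir.\<Phi> x'" if "x' \<in> choices G (paths G)" for x'
      unfolding pot by (rule min[OF compose_choices_in_choices[OF that y]])
    ultimately show ?thesis
      using x by (auto simp: solves_P_def is_arg_min_def not_less)
  qed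
  then have obedient: "obedient G \<upsilon> \<tau> law \<pi>'"
    using direct by (simp add: obedient_def)
  have bwe: "is_bwe G \<upsilon> \<tau> law Ms \<pi> (orig.flow y)"
    using assms(5) by (intro orig.variation_nonneg_imp_bwe y orig.minimiser_variation_nonneg) (simp_all add: P)
  \<comment> \<open>Obedience quantifies over all choices that follow recommendations; an explicit
    one is needed to obtain an equilibrium of the direct rule.\<close>
  define d where "d = obedient_choice G"
  have d: "d \<in> choices G (paths G)"
    unfolding d_def by (intro obedient_choice_in_choices) simp
  have d_id: "\<forall>u\<in>verts G. \<forall>v\<in>verts G. \<forall>i\<in>od_paths G u v. \<forall>j\<in>od_paths G u v.
      d u v i j = (if i = j then 1 else 0)"
    by (simp add: d_def obedient_choice_def)
  have "is_bwe G \<upsilon> \<tau> law (paths G) \<pi>' (dir.flow d)"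
    by (intro dir.variation_nonneg_imp_bwe d dir.minimiser_variation_nonneg solves d_id)
  then have bwe': "is_bwe G \<upsilon> \<tau> law (paths G) \<pi>' (orig.flow y)"
    by (rule dir.is_bwe_cong) (simp add: flow flow_id[OF d_id])
  have "(AE \<theta> in law. \<forall>e\<in>arcs G. f \<theta> e = g \<theta> e) \<and>
      system_cost G \<tau> \<Omega> \<Theta> f = system_cost G \<tau> \<Omega> \<Theta> g"
    if f: "is_bwe G \<upsilon> \<tau> law Ms \<pi> f" and g: "is_bwe G \<upsilon> \<tau> law (paths G) \<pi>' g" for f g
  proof
    \<comment> \<open>The flow of \<open>y\<close> is the link between \<open>f\<close> and
      \<open>g\<close>: uniqueness is applied once for each rule.\<close>
    show eq: "AE \<theta> in law. \<forall>e\<in>arcs G. f \<theta> e = g \<theta> e"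
      using orig.bwe_unique[OF f bwe] dir.bwe_unique[OF bwe' g] by eventually_elim simp
    show "system_cost G \<tau> \<Omega> \<Theta> f = system_cost G \<tau> \<Omega> \<Theta> g"
      unfolding system_cost_def
    proof (rule integral_cong_AE)
      \<comment> \<open>The almost sure equality under the law is pulled back along
        \<open>\<Theta>\<close>.\<close>
      show "AE \<omega> in \<Omega>. (\<Sum>e\<in>arcs G. f (\<Theta> \<omega>) e * \<tau> e (\<Theta> \<omega> e) (f (\<Theta> \<omega>) e)) =
          (\<Sum>e\<in>arcs G. g (\<Theta> \<omega>) e * \<tau> e (\<Theta> \<omega> e) (g (\<Theta> \<omega>) e))"
        using AE_distrD[OF state_measurable eq] by eventually_elim simp
    qed (rule orig.bwe_delay_cost_measurable[OF f] dir.bwe_delay_cost_measurable[OF g])+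
  qed
  with rules direct obedient bwe bwe' show ?thesis
    unfolding P by blast
qed

end
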